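(* Let $R$ be a commutative ring and $\kappa=|\pi_{0}\big(\operatorname{Spec}(R)\big)|$. Then $|\mathcal{B}(R)|<\infty$ if and only if $|\mathcal{B}(R)|=2^{\kappa}$.
   Context: All rings are commutative with $1$. $\mathcal{B}(R)=\{e\in R: e=e^{2}\}$ is the set of idempotents of $R$. $\pi_{0}(X)$ denotes the set (space) of connected components of a topological space $X$; $\operatorname{Spec}(R)$ carries the Zariski topology. $|X|$ denotes the cardinality of a set $X$, which may be infinite. *)

theory Defs
  imports "HOL-Analysis.Analysis" "HOL-Algebra.Algebra"
begin

unbundle cardinal_syntax

definition idempotents :: "('a, 'b) ring_scheme \<Rightarrow> 'a set" where
  "idempotents R = {e \<in> carrier R. e = e [^]\<^bsub>R\<^esub> (2::nat)}"

definition Spec :: "('a, 'b) ring_scheme \<Rightarrow> 'a set set" where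
  "Spec R = {P. primeideal P R}"

definition zero_locus :: "('a, 'b) ring_scheme \<Rightarrow> 'a set \<Rightarrow> 'a set set" where
  "zero_locus R S = {P \<in> Spec R. S \<subseteq> P}"

definition zariski_topology :: "('a, 'b) ring_scheme \<Rightarrow> 'a set topology" where
  "zariski_topology R =
     topology (\<lambda>U. \<exists>S \<subseteq> carrier R. U = Spec R - zero_locus R S)"

text \<open>The operator \<^term>\<open>topology\<close> is unspecified on predicates that do not satisfy
  \<^term>\<open>istopology\<close>; the next lemmas show that the definition above is meaningful.\<close>

lemma zero_locus_Un:
  assumes "S \<subseteq> carrier R" "T \<subseteq> carrier R"
  shows "zero_locus R S \<union> zero_locus R T = zero_locus R {s \<otimes>\<^bsub>R\<^esub> t |s t. s \<in> S \<and> t \<in> T}"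
    (is "?L = zero_locus R ?ST")
proof (intro equalityI subsetI)
  fix P assume "P \<in> ?L"
  then have P: "P \<in> Spec R" "S \<subseteq> P \<or> T \<subseteq> P"
    by (auto simp: zero_locus_def)
  then interpret primeideal P R by (simp add: Spec_def)
  have "?ST \<subseteq> P"
    using P(2) assms by (auto intro: I_l_closed I_r_closed)
  with P(1) show "P \<in> zero_locus R ?ST" by (simp add: zero_locus_def)
next
  fix P assume "P \<in> zero_locus R ?ST"
  then have P: "P \<in> Spec R" "?ST \<subseteq> P" by (auto simp: zero_locus_def)
  then interpret primeideal P R by (simp add: Spec_def)
  have "S \<subseteq> P \<or> T \<subseteq> P"
  proof (rule ccontr)
    assume "\<not> (S \<subseteq> P \<or> T \<subseteq> P)"
    then obtain s t where st: "s \<in> S" "s \<notin> P" "t \<in> T" "t \<notin> P" by blast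
    then have "s \<otimes>\<^bsub>R\<^esub> t \<in> P" using P(2) by blast
    with I_prime[of s t] st assms show False by blast
  qed
  with P(1) show "P \<in> ?L" by (auto simp: zero_locus_def)
qed

lemma istopology_zariski:
  "istopology (\<lambda>U. \<exists>S \<subseteq> carrier R. U = Spec R - zero_locus R S)"
  unfolding istopology_def
proof (intro conjI allI impI)
  fix U V
  assume "\<exists>S \<subseteq> carrier R. U = Spec R - zero_locus R S"
    and "\<exists>S \<subseteq> carrier R. V = Spec R - zero_locus R S"
  then obtain S T where ST: "S \<subseteq> carrier R" "T \<subseteq> carrier R"
    and UV: "U = Spec R - zero_locus R S" "V = Spec R - zero_locus R T" by blast
  show "\<exists>S \<subseteq> carrier R. U \<inter> V = Spec R - zero_locus R S"
  proof (cases "Spec R = {}")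
    case True
    then show ?thesis using UV by auto
  next
    case False
    then obtain P where "primeideal P R" by (auto simp: Spec_def)
    then interpret primeideal P R .
    have "{s \<otimes>\<^bsub>R\<^esub> t |s t. s \<in> S \<and> t \<in> T} \<subseteq> carrier R" using ST by auto
    moreover have "U \<inter> V = Spec R - zero_locus R {s \<otimes>\<^bsub>R\<^esub> t |s t. s \<in> S \<and> t \<in> T}"
      unfolding UV zero_locus_Un[OF ST, symmetric] by blast
    ultimately show ?thesis by blast
  qed
next
  fix \<K>
  assume "\<forall>K\<in>\<K>. \<exists>S \<subseteq> carrier R. K = Spec R - zero_locus R S"
  then obtain f where f: "\<And>K. K \<in> \<K> \<Longrightarrow> f K \<subseteq> carrier R \<and> K = Spec R - zero_locus R (f K)"
    by metis
  have "\<Union>\<K> = (\<Union>K\<in>\<K>. Spec R - zero_locus R (f K))" using f by auto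
  also have "\<dots> = Spec R - zero_locus R (\<Union>K\<in>\<K>. f K)"
    by (auto simp: zero_locus_def)
  finally show "\<exists>S \<subseteq> carrier R. \<Union>\<K> = Spec R - zero_locus R S"
    using f by (intro exI[of _ "\<Union>K\<in>\<K>. f K"]) auto
qed

lemma openin_zariski:
  "openin (zariski_topology R) U \<longleftrightarrow> (\<exists>S \<subseteq> carrier R. U = Spec R - zero_locus R S)"
  by (simp add: zariski_topology_def istopology_zariski topology_inverse')

lemma topspace_zariski:
  assumes "cring R"
  shows "topspace (zariski_topology R) = Spec R"
proof -
  interpret cring R by fact
  have "zero_locus R (carrier R) = {}"
  proof -
    have False if "primeideal P R" "carrier R \<subseteq> P" for P
    proof -
      interpret P: primeideal P R by fact
      show False using that(2) P.I_notcarr P.a_subset by blast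
    qed
    then show ?thesis by (auto simp: zero_locus_def Spec_def)
  qed
  then have "openin (zariski_topology R) (Spec R)"
    unfolding openin_zariski by blast
  moreover have "topspace (zariski_topology R) \<subseteq> Spec R"
    unfolding topspace_def openin_zariski by blast
  ultimately show ?thesis by (simp add: openin_subset subset_antisym)
qed

text \<open>\<open>\<pi>\<^sub>0\<close> of the spectrum is \<^term>\<open>connected_components_of (zariski_topology R)\<close>, which is empty
  for the zero ring. For cardinals, \<open>ctwo ^c \<kappa>\<close> is the cardinal power \<open>2\<^sup>\<kappa>\<close> and \<open>=o\<close> is equality
  of cardinals represented as well-orders, possibly over different types.\<close>

end

(* Idempotents of R correspond to the clopen subsets of the compact space Spec R, so this is a
   statement about the set B of clopen subsets of a compact space X. If B is finite, then the
   connected components are finitely many and clopen, so B consists of all their unions. If B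
   is infinite, choose for each pair of components a clopen set separating them when there is one;
   by compactness every clopen set is a finite union of finite intersections of the chosen sets.
   Hence |B| is at most |Fpow (Fpow (K \<times> K))| for the set K of components, so K is infinite
   and |B| \<le> |K| < 2 ^ |K|. *)

theory Submission
  imports Defs
begin

section \<open>Clopen sets and connected components\<close>

definition clopens :: "'a topology \<Rightarrow> 'a set set" where
  "clopens T = {U. openin T U \<and> closedin T U}"

text \<open>A quasi-component is determined by the family of clopen sets containing any one of its
  points, so quasi-components inject into the subsets of \<open>clopens T\<close>.\<close>

lemma finite_clopens_imp_finite_quasi_components:
  assumes "finite (clopens T)"
  shows "finite (quasi_components_of T)"
proof -
  have "quasi_component_of_set T x = {y \<in> topspace T. {V \<in> clopens T. y \<in> V} = {V \<in> clopens T. x \<in> V}}"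
    if "x \<in> topspace T" for x
    using that by (auto simp: quasi_component_of_def clopens_def set_eq_iff)
  then have "quasi_components_of T \<subseteq>
      (\<lambda>\<T>. {y \<in> topspace T. {V \<in> clopens T. y \<in> V} = \<T>}) ` Pow (clopens T)"
    unfolding quasi_components_of_def by auto
  with assms show ?thesis
    by (meson finite_Pow_iff finite_imageI finite_subset)
qed

text \<open>When there are finitely many quasi-components, they are open and agree with the
  connected components, so \<open>Union\<close> is a bijection from sets of components to clopen
  sets. The empty space fits: one clopen set, no component.\<close>

lemma finite_clopens_eqpoll_Pow_components:
  assumes "finite (clopens T)"
  shows "clopens T \<approx> Pow (connected_components_of T)"
proof -
  let ?K = "connected_components_of T"
  have fin: "finite (quasi_components_of T)"
    using assms by (rule finite_clopens_imp_finite_quasi_components)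
  then have eq: "quasi_components_of T = ?K"
    by (intro quasi_eq_connected_components_of) blast
  have finK: "finite ?K" and openK: "\<And>C. C \<in> ?K \<Longrightarrow> openin T C"
    using fin openin_finite_quasi_components[OF fin] by (simp_all add: eq)
  have "bij_betw Union (Pow ?K) (clopens T)"
  proof (rule bij_betw_imageI, rule inj_onI)
    fix F G assume FG: "F \<in> Pow ?K" "G \<in> Pow ?K" "\<Union>F = \<Union>G"
    \<comment> \<open>Components are nonempty and pairwise disjoint, so any point of
      \<open>C\<close> already identifies \<open>C\<close> among the members of
      \<open>B\<close>.\<close>
    have sub: "A \<subseteq> B" if AB: "A \<subseteq> ?K" "B \<subseteq> ?K" "\<Union>A = \<Union>B" for A B
    proof
      fix C assume C: "C \<in> A"
      then obtain x where "x \<in> C"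
        using AB(1) nonempty_connected_components_of by blast
      moreover from this obtain D where D: "D \<in> B" "x \<in> D"
        using C AB(3) by blast
      ultimately have "C = D"
        using connected_components_of_overlap[of C T D] C AB(1,2) by blast
      with D show "C \<in> B" by simp
    qed
    show "F = G" using sub[of F G] sub[of G F] FG by auto
  next
    show "Union ` Pow ?K = clopens T"
    proof (intro equalityI subsetI)
      fix U assume "U \<in> Union ` Pow ?K"
      then obtain F where F: "F \<subseteq> ?K" "U = \<Union>F" by blast
      have "finite F"
        using F(1) finK by (rule finite_subset)
      then show "U \<in> clopens T"
        using F openK closedin_connected_components_of unfolding clopens_def
        by (auto intro!: openin_Union closedin_Union)
    next
      fix U assume U: "U \<in> clopens T"
      have "U = \<Union>{C \<in> ?K. C \<subseteq> U}"
      proof (intro equalityI subsetI)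
        fix x assume x: "x \<in> U"
        then have "x \<in> topspace T"
          using U openin_subset[of T U] by (auto simp: clopens_def)
        then obtain C where C: "C \<in> ?K" "x \<in> C"
          unfolding Union_connected_components_of[symmetric] by blast
        have "C \<subseteq> U \<or> disjnt C U"
          using U by (intro connectedin_clopen_cases[OF connectedin_connected_components_of[OF C(1)]])
            (simp_all add: clopens_def)
        with C(2) x have "C \<subseteq> U"
          unfolding disjnt_iff by blast
        with C show "x \<in> \<Union>{C \<in> ?K. C \<subseteq> U}" by blast
      qed blast
      then show "U \<in> Union ` Pow ?K" by blast
    qed
  qed
  then have "Pow ?K \<approx> clopens T"
    by (auto simp: eqpoll_def)
  then show ?thesis
    by (rule eqpoll_sym)
qed

section \<open>Counting the clopen sets of a compact space\<close>

lemma compactin_finite_subfamily: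
  assumes "compactin T K" "\<And>x. x \<in> K \<Longrightarrow> openin T (f x) \<and> x \<in> f x"
  obtains F where "finite F" "F \<subseteq> K" "K \<subseteq> \<Union>(f ` F)"
proof -
  have "\<exists>\<F>. finite \<F> \<and> \<F> \<subseteq> f ` K \<and> K \<subseteq> \<Union>\<F>"
    using assms by (intro compactinD[OF assms(1)]) auto
  then show ?thesis
    using that by (metis finite_subset_image)
qed

text \<open>Every clopen set can be decoded from a finite set of finite sets of pairs of components,
  by the map taking \<open>F\<close> to the union of the cells of its members. The image of this map
  may contain more than the clopen sets.\<close>

lemma compact_space_clopens_lepoll:
  assumes "compact_space T"
  shows "clopens T \<lesssim> Fpow (Fpow (connected_components_of T \<times> connected_components_of T))"
proof -
  let ?K = "connected_components_of T"
  \<comment> \<open>The choice depends on the pair alone and not on the clopen set to be described;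
    this is what makes the count work. For inseparable pairs the value is arbitrary and
    harmless.\<close>
  define sep where "sep = (\<lambda>(C, D). SOME W. W \<in> clopens T \<and> C \<subseteq> W \<and> D \<inter> W = {})"
  define comp where "comp = connected_component_of_set T"
  \<comment> \<open>Intersecting with \<open>topspace T\<close> makes the cell of the empty set the
    whole space.\<close>
  define cell where "cell A = topspace T \<inter> \<Inter>(sep ` A)" for A
  have comp: "comp x \<in> ?K" "x \<in> comp x" if "x \<in> topspace T" for x
    using that unfolding comp_def
    by (simp_all add: connected_component_in_connected_components_of connected_component_of_refl)
  have comp_cases: "comp x \<subseteq> U \<or> comp x \<inter> U = {}" if "U \<in> clopens T" for x U
    using connectedin_clopen_cases[OF connectedin_connected_component_of, of T U x] that
    by (auto simp: clopens_def disjnt_def comp_def)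
  have "U \<in> (\<lambda>F. \<Union>(cell ` F)) ` Fpow (Fpow (?K \<times> ?K))" if U: "U \<in> clopens T" for U
  proof -
    have Utop: "U \<subseteq> topspace T" and Uo: "openin T U" and Uc: "closedin T U"
      using U openin_subset by (auto simp: clopens_def)
    have sep: "sep (comp x, comp y) \<in> clopens T \<and> comp x \<subseteq> sep (comp x, comp y)
        \<and> comp y \<inter> sep (comp x, comp y) = {}"
      if "x \<in> U" "y \<in> topspace T - U" for x y
    proof -
      \<comment> \<open>\<open>U\<close> itself separates the two components, so the choice in
        \<open>sep\<close> succeeds.\<close>
      have "comp x \<subseteq> U" "comp y \<inter> U = {}"
        using comp_cases[OF U, of x] comp_cases[OF U, of y] comp(2)[of x] comp(2)[of y] that Utop
        by blast+
      then show ?thesis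
        unfolding sep_def prod.case by (intro someI_ex[of "\<lambda>W. W \<in> clopens T \<and> _ W"]) (use U in blast)
    qed
    \<comment> \<open>The complement of \<open>U\<close> is compact and covered by the complements
      of the sets \<open>sep (comp x, comp y)\<close>. Finitely many \<open>y\<close> suffice, and
      the intersection of their separating sets is a neighbourhood of \<open>x\<close> inside
      \<open>U\<close>.\<close>
    have "\<exists>A \<in> Fpow (?K \<times> ?K). openin T (cell A) \<and> x \<in> cell A \<and> cell A \<subseteq> U" if x: "x \<in> U" for x
    proof -
      have "compactin T (topspace T - U)"
        using assms Uo by (intro closedin_compact_space) auto
      moreover have "openin T (topspace T - sep (comp x, comp y)) \<and> y \<in> topspace T - sep (comp x, comp y)"
        if "y \<in> topspace T - U" for y
        using sep[OF x that] comp(2)[of y] that by (auto simp: clopens_def)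
      ultimately obtain Y where Y: "finite Y" "Y \<subseteq> topspace T - U"
          "topspace T - U \<subseteq> (\<Union>y\<in>Y. topspace T - sep (comp x, comp y))"
        by (rule compactin_finite_subfamily)
      define A where "A = (\<lambda>y. (comp x, comp y)) ` Y"
      have cellA: "cell A = topspace T \<inter> (\<Inter>y\<in>Y. sep (comp x, comp y))"
        by (auto simp: cell_def A_def)
      have "A \<in> Fpow (?K \<times> ?K)"
        using Y comp(1) x Utop by (auto simp: A_def Fpow_def)
      moreover have "openin T (cell A)"
      proof (cases "Y = {}")
        case False
        then have "openin T (\<Inter>y\<in>Y. sep (comp x, comp y))"
          using Y sep[OF x] by (intro openin_Inter) (auto simp: clopens_def)
        then show ?thesis unfolding cellA by blast
      qed (simp add: cellA)
      moreover have "x \<in> cell A"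
        using x Utop Y(2) sep[OF x] comp(2)[of x] unfolding cellA by blast
      moreover have "cell A \<subseteq> U"
        using Y(3) unfolding cellA by blast
      ultimately show ?thesis by blast
    qed
    then obtain A where A: "\<And>x. x \<in> U \<Longrightarrow> A x \<in> Fpow (?K \<times> ?K)"
        "\<And>x. x \<in> U \<Longrightarrow> openin T (cell (A x)) \<and> x \<in> cell (A x)" "\<And>x. x \<in> U \<Longrightarrow> cell (A x) \<subseteq> U"
      by metis
    \<comment> \<open>Compactness is used a second time: finitely many of these cells cover
      \<open>U\<close>, and none leaves it.\<close>
    have "compactin T U"
      using assms Uc by (rule closedin_compact_space)
    then obtain Z where Z: "finite Z" "Z \<subseteq> U" "U \<subseteq> \<Union>((\<lambda>x. cell (A x)) ` Z)"
      using A(2) by (rule compactin_finite_subfamily)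
    have "A ` Z \<in> Fpow (Fpow (?K \<times> ?K))"
      using Z A(1) by (auto simp: Fpow_def[of "Fpow _"])
    moreover have "U = \<Union>(cell ` A ` Z)"
      using Z A(3) by (auto simp: image_image)
    ultimately show ?thesis by blast
  qed
  then have "clopens T \<subseteq> (\<lambda>F. \<Union>(cell ` F)) ` Fpow (Fpow (?K \<times> ?K))"
    by blast
  then show ?thesis
    using subset_image_lepoll by blast
qed

section \<open>Comparison with the power of two\<close>

lemma card_of_Pow_ctwo: "|Pow A| =o ctwo ^c |A|"
  unfolding ctwo_def cexp_def Field_card_of by (rule card_of_Pow_Func)

theorem compact_space_finite_clopens_iff:
  assumes "compact_space T"
  shows "finite (clopens T) \<longleftrightarrow> |clopens T| =o ctwo ^c |connected_components_of T|"
proof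
  let ?K = "connected_components_of T"
  show "|clopens T| =o ctwo ^c |?K|" if "finite (clopens T)"
    using finite_clopens_eqpoll_Pow_components[OF that] card_of_Pow_ctwo
    unfolding eqpoll_iff_card_of_ordIso by (rule ordIso_transitive)
  assume iso: "|clopens T| =o ctwo ^c |?K|"
  show "finite (clopens T)"
  proof (rule ccontr)
    assume inf: "infinite (clopens T)"
    have le: "|clopens T| \<le>o |Fpow (Fpow (?K \<times> ?K))|"
      using compact_space_clopens_lepoll[OF assms] by (simp add: lepoll_def card_of_ordLeq)
    have infK: "infinite (?K \<times> ?K)"
    proof
      assume "finite (?K \<times> ?K)"
      then have "finite (Fpow (Fpow (?K \<times> ?K)))"
        by (simp add: Fpow_Pow_finite)
      with le inf show False
        using card_of_ordLeq_infinite by blast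
    qed
    then have "infinite ?K" by blast
    have "infinite (Fpow (?K \<times> ?K))"
      using infK card_of_Fpow card_of_ordLeq_infinite by blast
    \<comment> \<open>Neither finite subsets nor pairs increase an infinite cardinal, so the bound
      collapses to that of the components.\<close>
    from card_of_Fpow_infinite[OF this] card_of_Fpow_infinite[OF infK]
    have "|Fpow (Fpow (?K \<times> ?K))| =o |?K \<times> ?K|"
      by (rule ordIso_transitive)
    from this card_of_Times_same_infinite[OF \<open>infinite ?K\<close>]
    have "|Fpow (Fpow (?K \<times> ?K))| =o |?K|"
      by (rule ordIso_transitive)
    with le have "|clopens T| \<le>o |?K|"
      by (rule ordLeq_ordIso_trans)
    moreover have "|?K| <o ctwo ^c |?K|"
      by (rule ordLess_ctwo_cexp) simp
    ultimately have "|clopens T| <o ctwo ^c |?K|"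
      by (rule ordLeq_ordLess_trans)
    then show False
      using iso not_ordLess_ordIso by blast
  qed
qed

section \<open>Prime ideals\<close>

text \<open>Zorn gives an ideal maximal among those that contain \<open>I\<close> and miss the
  multiplicative set \<open>S\<close>. It is prime: enlarging it by \<open>a\<close> or by
  \<open>b\<close> outside it makes it meet \<open>S\<close>, and multiplying the two elements found
  shows that it cannot contain the product of \<open>a\<close> and \<open>b\<close>.\<close>

lemma (in cring) exists_primeideal_avoiding:
  assumes I: "ideal I R" and S: "S \<subseteq> carrier R" "\<one> \<in> S"
    and S_mult: "\<And>s t. s \<in> S \<Longrightarrow> t \<in> S \<Longrightarrow> s \<otimes> t \<in> S" and disj: "I \<inter> S = {}"
  obtains P where "primeideal P R" "I \<subseteq> P" "P \<inter> S = {}"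
proof -
  let ?\<A> = "{J. ideal J R \<and> I \<subseteq> J \<and> J \<inter> S = {}}"
  have "\<exists>M\<in>?\<A>. \<forall>J\<in>?\<A>. M \<subseteq> J \<longrightarrow> J = M"
  proof (rule subset_Zorn_nonempty)
    show "?\<A> \<noteq> {}" using I disj by blast
    fix \<C> assume \<C>: "\<C> \<noteq> {}" "subset.chain ?\<A> \<C>"
    then have "subset.chain {J. ideal J R} \<C>"
      by (auto simp: pred_on.chain_def)
    then have "ideal (\<Union>\<C>) R"
      using chain_Union_is_ideal[of \<C>] \<C>(1) by simp
    moreover have "I \<subseteq> \<Union>\<C>" "\<Union>\<C> \<inter> S = {}"
      using \<C> unfolding pred_on.chain_def by blast+
    ultimately show "\<Union>\<C> \<in> ?\<A>" by blast
  qed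
  then obtain M where MA: "M \<in> ?\<A>" and maxA: "\<forall>J\<in>?\<A>. M \<subseteq> J \<longrightarrow> J = M"
    by (rule bexE)
  from MA have M: "ideal M R" "I \<subseteq> M" "M \<inter> S = {}"
    by simp_all
  from maxA have max: "J = M" if "ideal J R" "I \<subseteq> J" "J \<inter> S = {}" "M \<subseteq> J" for J
    using that by simp
  interpret M: ideal M R by (rule M(1))
  have meets: "\<exists>m\<in>M. \<exists>x\<in>carrier R. m \<oplus> x \<otimes> a \<in> S" if a: "a \<in> carrier R" "a \<notin> M" for a
  proof -
    let ?J = "M <+>\<^bsub>R\<^esub> PIdl a"
    have J: "ideal ?J R"
      using add_ideals[OF M(1) cgenideal_ideal[OF a(1)]] .
    have memJ: "z \<in> ?J \<longleftrightarrow> (\<exists>m\<in>M. \<exists>x\<in>carrier R. z = m \<oplus> x \<otimes> a)" for z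
      by (auto simp: set_add_def' cgenideal_def)
    have "M \<subseteq> ?J"
    proof
      fix m assume "m \<in> M"
      then show "m \<in> ?J"
        unfolding memJ using a(1) by (intro bexI[of _ m] bexI[of _ \<zero>]) auto
    qed
    moreover have "a \<in> ?J"
      unfolding memJ using a(1) by (intro bexI[of _ \<zero>] bexI[of _ \<one>]) auto
    ultimately have "?J \<inter> S \<noteq> {}"
      using max[OF J] M(2) a(2) by blast
    then show ?thesis unfolding disjoint_iff by (auto simp: memJ)
  qed
  have "primeideal M R"
  proof (rule primeidealI[OF M(1) is_cring])
    show "carrier R \<noteq> M" using S(2) M(3) by auto
    fix a b assume a: "a \<in> carrier R" and b: "b \<in> carrier R" and ab: "a \<otimes> b \<in> M"
    show "a \<in> M \<or> b \<in> M"
    proof (rule ccontr)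
      assume "\<not> (a \<in> M \<or> b \<in> M)"
      then obtain m x n y where m: "m \<in> M" "x \<in> carrier R" "m \<oplus> x \<otimes> a \<in> S"
        and n: "n \<in> M" "y \<in> carrier R" "n \<oplus> y \<otimes> b \<in> S"
        using meets[OF a] meets[OF b] by blast
      have [simp]: "m \<in> carrier R" "n \<in> carrier R" using m n M.Icarr by auto
      \<comment> \<open>The product is grouped so that each summand has a factor in
        \<open>M\<close>, namely \<open>m\<close>, \<open>n\<close> or
        \<open>a \<otimes> b\<close>.\<close>
      have "(m \<oplus> x \<otimes> a) \<otimes> (n \<oplus> y \<otimes> b)
          = m \<otimes> (n \<oplus> y \<otimes> b) \<oplus> ((x \<otimes> a) \<otimes> n \<oplus> (x \<otimes> y) \<otimes> (a \<otimes> b))"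
        using a b m(2) n(2) by (simp add: l_distr r_distr m_ac a_ac)
      also have "\<dots> \<in> M"
        using a b m(2) n(2)
        by (intro M.a_closed M.I_r_closed[OF m(1)] M.I_l_closed[OF n(1)] M.I_l_closed[OF ab]) auto
      finally show False
        using S_mult[OF m(3) n(3)] M(3) by blast
    qed
  qed
  with M that show thesis by blast
qed

text \<open>Avoiding the multiplicative set \<open>{\<one>}\<close> shows that a proper ideal lies
  in some prime; this is the contrapositive.\<close>

lemma (in cring) one_mem_ideal_if_no_prime:
  assumes "ideal I R" "\<And>P. primeideal P R \<Longrightarrow> \<not> I \<subseteq> P"
  shows "\<one> \<in> I"
proof (rule ccontr)
  assume "\<one> \<notin> I"
  then show False
    using exists_primeideal_avoiding[OF assms(1), of "{\<one>}"] assms(2) by auto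
qed

lemma (in primeideal) pow_mem_imp_mem:
  assumes "a \<in> carrier R" "a [^] (n::nat) \<in> I"
  shows "a \<in> I"
  using assms(2)
proof (induction n)
  case 0
  then show ?case using assms(1) one_imp_carrier I_notcarr by auto
next
  case (Suc n)
  then show ?case using I_prime[of "a [^] n" a] assms(1) by auto
qed

lemma (in primeideal) one_notin: "\<one> \<notin> I"
  using one_imp_carrier I_notcarr by blast

text \<open>If no power of \<open>c\<close> vanishes, the powers form a multiplicative set missing
  the zero ideal, and a prime avoiding them does not contain \<open>c\<close>.\<close>

lemma (in cring) nilpotent_if_in_all_primes:
  assumes c: "c \<in> carrier R" and mem: "\<And>P. primeideal P R \<Longrightarrow> c \<in> P"
  shows "\<exists>n::nat. c [^] n = \<zero>"
proof (rule ccontr)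
  assume "\<not> (\<exists>n::nat. c [^] n = \<zero>)"
  then have disj: "{\<zero>} \<inter> range (\<lambda>n::nat. c [^] n) = {}" by force
  have "\<one> \<in> range (\<lambda>n::nat. c [^] n)"
    using nat_pow_0[of c] by (metis rangeI)
  moreover have "s \<otimes> t \<in> range (\<lambda>n::nat. c [^] n)"
    if "s \<in> range (\<lambda>n::nat. c [^] n)" "t \<in> range (\<lambda>n::nat. c [^] n)" for s t
    using that c by (auto simp: nat_pow_mult)
  ultimately obtain P where P: "primeideal P R" "P \<inter> range (\<lambda>n::nat. c [^] n) = {}"
    using exists_primeideal_avoiding[OF zeroideal _ _ _ disj] c by (metis (no_types, lifting) image_subsetI nat_pow_closed)
  have "c [^] (1::nat) \<notin> P" using P(2) by blast
  with mem[OF P(1)] c show False by simp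
qed

section \<open>The spectrum and its clopen subsets\<close>

text \<open>The ideals generated by finite subsets of \<open>A\<close> are directed under inclusion,
  so their union is an ideal; it contains \<open>A\<close> and hence \<open>Idl A\<close>.\<close>

lemma (in ring) mem_genideal_finite_subset:
  assumes A: "A \<subseteq> carrier R" and a: "a \<in> Idl A"
  obtains F where "finite F" "F \<subseteq> A" "a \<in> Idl F"
proof -
  let ?J = "{x. \<exists>F. finite F \<and> F \<subseteq> A \<and> x \<in> Idl F}"
  have idl: "ideal (Idl F) R" if "F \<subseteq> A" for F
    using genideal_ideal that A by blast
  have mono: "Idl F \<subseteq> Idl G" if "F \<subseteq> G" "G \<subseteq> A" for F G
    using subset_Idl_subset that A by (meson subset_trans)
  have "ideal ?J R"
  proof (rule idealI[OF ring_axioms])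
    show "subgroup ?J (add_monoid R)"
    proof
      show "?J \<subseteq> carrier (add_monoid R)"
        using ideal.Icarr[OF idl] by fastforce
      show "\<one>\<^bsub>add_monoid R\<^esub> \<in> ?J"
        using additive_subgroup.zero_closed[OF ideal.axioms(1)[OF idl[of "{}"]]] by auto
    next
      fix x y assume "x \<in> ?J" "y \<in> ?J"
      then obtain F G where "finite F" "F \<subseteq> A" "x \<in> Idl F" "finite G" "G \<subseteq> A" "y \<in> Idl G"
        by blast
      then have FG: "finite (F \<union> G)" "F \<union> G \<subseteq> A" "x \<in> Idl (F \<union> G)" "y \<in> Idl (F \<union> G)"
        using mono[of F "F \<union> G"] mono[of G "F \<union> G"] by auto
      then have "x \<oplus> y \<in> Idl (F \<union> G)"
        using additive_subgroup.a_closed[OF ideal.axioms(1)[OF idl[OF FG(2)]]] by simp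
      with FG show "x \<otimes>\<^bsub>add_monoid R\<^esub> y \<in> ?J" by auto
    next
      fix x assume "x \<in> ?J"
      then obtain F where "finite F" "F \<subseteq> A" "x \<in> Idl F" by blast
      then have "finite F \<and> F \<subseteq> A \<and> \<ominus> x \<in> Idl F"
        using additive_subgroup.a_inv_closed[OF ideal.axioms(1)[OF idl[of F]]] by simp
      then show "inv\<^bsub>add_monoid R\<^esub> x \<in> ?J"
        by (auto simp: a_inv_def)
    qed
  next
    fix x r assume "x \<in> ?J" and r: "r \<in> carrier R"
    then obtain F where F: "finite F" "F \<subseteq> A" "x \<in> Idl F" by blast
    then show "r \<otimes> x \<in> ?J" "x \<otimes> r \<in> ?J"
      using ideal.I_l_closed[OF idl[OF F(2)] F(3) r] ideal.I_r_closed[OF idl[OF F(2)] F(3) r] by blast+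
  qed
  moreover have "A \<subseteq> ?J"
  proof
    fix x assume "x \<in> A"
    then show "x \<in> ?J"
      using genideal_self'[of x] A by (intro CollectI exI[of _ "{x}"]) auto
  qed
  ultimately have "Idl A \<subseteq> ?J"
    by (rule genideal_minimal)
  then show thesis using a that by blast
qed

text \<open>No prime contains all the sets that define a cover, so together they generate the unit
  ideal. Finitely many elements already generate \<open>\<one>\<close>, and one member of the cover
  for each of them gives a finite subcover.\<close>

lemma (in cring) compact_space_zariski: "compact_space (zariski_topology R)"
  unfolding compact_space_alt topspace_zariski[OF is_cring]
proof (intro allI impI)
  fix \<U> assume "(\<forall>U\<in>\<U>. openin (zariski_topology R) U) \<and> Spec R \<subseteq> \<Union>\<U>"
  then have "\<forall>U\<in>\<U>. \<exists>S\<subseteq>carrier R. U = Spec R - zero_locus R S" and cover: "Spec R \<subseteq> \<Union>\<U>"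
    by (auto simp: openin_zariski)
  then obtain S where S: "\<And>U. U \<in> \<U> \<Longrightarrow> S U \<subseteq> carrier R"
      "\<And>U. U \<in> \<U> \<Longrightarrow> U = Spec R - zero_locus R (S U)"
    by metis
  let ?A = "\<Union>(S ` \<U>)"
  have A: "?A \<subseteq> carrier R" using S(1) by blast
  have "\<one> \<in> Idl ?A"
  proof (rule one_mem_ideal_if_no_prime[OF genideal_ideal[OF A]])
    fix P assume P: "primeideal P R"
    then obtain U where U: "U \<in> \<U>" "P \<in> U"
      using cover by (auto simp: Spec_def)
    then have "\<not> S U \<subseteq> P"
      using S(2)[OF U(1)] by (auto simp: zero_locus_def)
    then show "\<not> Idl ?A \<subseteq> P"
      using genideal_self[OF A] U(1) by blast
  qed
  then obtain F where F: "finite F" "F \<subseteq> ?A" "\<one> \<in> Idl F"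
    using mem_genideal_finite_subset[OF A] by blast
  then obtain u where u: "\<And>f. f \<in> F \<Longrightarrow> u f \<in> \<U> \<and> f \<in> S (u f)"
    by (metis (no_types, lifting) UN_iff subsetD)
  have "P \<in> \<Union>(u ` F)" if P: "P \<in> Spec R" for P
  proof -
    interpret P: primeideal P R using P by (simp add: Spec_def)
    have "\<not> F \<subseteq> P"
      using genideal_minimal[OF P.is_ideal, of F] F(3) P.one_notin by blast
    then obtain f where f: "f \<in> F" "f \<notin> P" by blast
    then have "P \<in> u f"
      using S(2)[of "u f"] u[OF f(1)] P by (auto simp: zero_locus_def)
    with f(1) show ?thesis by blast
  qed
  then show "\<exists>\<F>. finite \<F> \<and> \<F> \<subseteq> \<U> \<and> Spec R \<subseteq> \<Union>\<F>"
    using F(1) u by (intro exI[of _ "u ` F"]) auto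
qed

section \<open>Idempotents as clopen subsets of the spectrum\<close>

definition basic_open :: "('a, 'b) ring_scheme \<Rightarrow> 'a \<Rightarrow> 'a set set" where
  "basic_open R a = {P \<in> Spec R. a \<notin> P}"

lemma basic_open_eq: "basic_open R a = Spec R - zero_locus R {a}"
  by (auto simp: basic_open_def zero_locus_def)

context cring
begin

lemma idempotents_iff: "e \<in> idempotents R \<longleftrightarrow> e \<in> carrier R \<and> e \<otimes> e = e"
  by (auto simp: idempotents_def numeral_2_eq_2)

text \<open>The zero product forces one of the two elements into \<open>P\<close>, and the sum
  \<open>\<one>\<close> keeps them from both lying there. The form with a general \<open>f\<close>
  also serves the pair built from powers below.\<close>

lemma mem_primeideal_iff_complement_notin:
  assumes P: "primeideal P R" and e: "e \<in> carrier R" "f \<in> carrier R" "e \<oplus> f = \<one>" "e \<otimes> f = \<zero>"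
  shows "e \<in> P \<longleftrightarrow> f \<notin> P"
proof -
  interpret P: primeideal P R by fact
  show ?thesis
    using P.I_prime[of e f] P.a_closed[of e f] P.one_notin e P.zero_closed by auto
qed

lemma idempotent_complement:
  assumes "e \<in> idempotents R"
  shows "e \<in> carrier R" "\<one> \<ominus> e \<in> carrier R" "e \<oplus> (\<one> \<ominus> e) = \<one>" "e \<otimes> (\<one> \<ominus> e) = \<zero>"
proof -
  show e: "e \<in> carrier R" and "\<one> \<ominus> e \<in> carrier R"
    using assms by (auto simp: idempotents_iff)
  show "e \<oplus> (\<one> \<ominus> e) = \<one>"
    using e by (simp add: minus_eq a_comm[of \<one>] r_neg2)
  show "e \<otimes> (\<one> \<ominus> e) = \<zero>"
    using e assms by (simp add: minus_eq r_distr r_minus r_neg idempotents_iff)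
qed

text \<open>The complement is again basic open, given by \<open>\<one> \<ominus> e\<close>.\<close>

lemma basic_open_idempotent_clopen:
  assumes "e \<in> idempotents R"
  shows "basic_open R e \<in> clopens (zariski_topology R)"
proof -
  note e = idempotent_complement[OF assms]
  have "openin (zariski_topology R) (basic_open R a)" if "a \<in> carrier R" for a
    unfolding openin_zariski basic_open_eq using that by blast
  moreover have "Spec R - basic_open R e = basic_open R (\<one> \<ominus> e)"
    using mem_primeideal_iff_complement_notin[OF _ e] by (auto simp: basic_open_def Spec_def)
  ultimately show ?thesis
    using e by (auto simp: clopens_def closedin_def topspace_zariski[OF is_cring] basic_open_def)
qed

text \<open>If \<open>e\<close> and \<open>f\<close> lie in the same primes, the idempotent
  \<open>e \<otimes> (\<one> \<ominus> f)\<close> lies in every prime. It is then nilpotent, hence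
  zero, so \<open>e = e \<otimes> f\<close>; by symmetry this product also equals
  \<open>f\<close>.\<close>

lemma inj_on_basic_open_idempotents: "inj_on (basic_open R) (idempotents R)"
proof -
  have absorb: "e \<otimes> f = e"
    if e: "e \<in> idempotents R" and f: "f \<in> idempotents R" and eq: "basic_open R e = basic_open R f" for e f
  proof -
    note e' = idempotent_complement[OF e] and f' = idempotent_complement[OF f]
    let ?c = "e \<otimes> (\<one> \<ominus> f)"
    have "(\<one> \<ominus> f) \<otimes> (\<one> \<ominus> f) = (\<one> \<ominus> f) \<ominus> f \<otimes> (\<one> \<ominus> f)"
      using f'(1,2) by (simp add: minus_eq l_distr l_minus)
    also have "\<dots> = \<one> \<ominus> f"
      using f' by (simp add: minus_eq)
    finally have "(\<one> \<ominus> f) \<otimes> (\<one> \<ominus> f) = \<one> \<ominus> f" .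
    moreover have "?c \<otimes> ?c = (e \<otimes> e) \<otimes> ((\<one> \<ominus> f) \<otimes> (\<one> \<ominus> f))"
      using e'(1) f'(2) by (simp add: m_ac)
    ultimately have "?c \<otimes> ?c = ?c"
      using e by (simp add: idempotents_iff)
    have "?c \<in> P" if P: "primeideal P R" for P
    proof -
      interpret P: primeideal P R by fact
      have "P \<in> basic_open R e \<longleftrightarrow> P \<in> basic_open R f"
        by (simp only: eq)
      then have "e \<in> P \<longleftrightarrow> f \<in> P"
        using P by (simp add: basic_open_def Spec_def)
      then have "e \<in> P \<or> \<one> \<ominus> f \<in> P"
        using mem_primeideal_iff_complement_notin[OF P f'] by blast
      then show ?thesis
        using P.I_l_closed[OF _ e'(1)] P.I_r_closed[OF _ f'(2)] by blast
    qed
    then obtain n :: nat where n: "?c [^] n = \<zero>"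
      using nilpotent_if_in_all_primes[of ?c] e'(1) f'(2) by blast
    have "?c [^] Suc k = ?c" for k :: nat
      using \<open>?c \<otimes> ?c = ?c\<close> e'(1) f'(2) by (induction k) auto
    moreover have "?c [^] Suc n = \<zero>"
      using n e'(1) f'(2) by simp
    ultimately have "?c = \<zero>" by metis
    moreover have "e = e \<otimes> (f \<oplus> (\<one> \<ominus> f))"
      using e'(1) f'(3) by simp
    ultimately show ?thesis
      using e'(1) f'(1,2) by (simp add: r_distr)
  qed
  show ?thesis
  proof (rule inj_onI)
    fix e f assume *: "e \<in> idempotents R" "f \<in> idempotents R" "basic_open R e = basic_open R f"
    then have "e = e \<otimes> f" by (simp add: absorb)
    also have "\<dots> = f \<otimes> e"
      using * by (auto simp: idempotents_iff m_comm)
    also have "\<dots> = f"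
      using * by (simp add: absorb)
    finally show "e = f" .
  qed
qed

text \<open>If \<open>U\<close> and its complement are the zero loci of \<open>A\<close> and \<open>B\<close>, there are comaximal \<open>a\<close> and \<open>b\<close> in
  the ideals generated by \<open>A\<close> and \<open>B\<close> with nilpotent product. Powers \<open>a\<^sup>n\<close> and \<open>b\<^sup>n\<close> are still comaximal,
  and their product vanishes for large \<open>n\<close>, so the two terms of \<open>x a\<^sup>n + y b\<^sup>n = \<one>\<close> are
  complementary idempotents.\<close>
lemma clopen_is_basic_open:
  assumes U: "U \<in> clopens (zariski_topology R)"
  shows "U \<in> basic_open R ` idempotents R"
proof -
  have Usub: "U \<subseteq> Spec R"
    using U openin_subset topspace_zariski[OF is_cring] by (fastforce simp: clopens_def)
  obtain B where B: "B \<subseteq> carrier R" "U = Spec R - zero_locus R B"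
    using U by (auto simp: clopens_def openin_zariski)
  obtain A where A: "A \<subseteq> carrier R" "Spec R - U = Spec R - zero_locus R A"
    using U by (auto simp: clopens_def openin_zariski closedin_def topspace_zariski[OF is_cring])
  have inU: "P \<in> U \<longleftrightarrow> A \<subseteq> P" and notinU: "P \<notin> U \<longleftrightarrow> B \<subseteq> P" if "primeideal P R" for P
    using that A(2) B(2) by (auto simp: zero_locus_def Spec_def)
  have idA: "ideal (Idl A) R" and idB: "ideal (Idl B) R"
    using A(1) B(1) by (auto intro: genideal_ideal)
  interpret IA: ideal "Idl A" R by (rule idA)
  interpret IB: ideal "Idl B" R by (rule idB)
  have inUI: "P \<in> U \<longleftrightarrow> Idl A \<subseteq> P" and notinUI: "P \<notin> U \<longleftrightarrow> Idl B \<subseteq> P" if "primeideal P R" for P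
    using inU[OF that] notinU[OF that] Idl_subset_ideal[OF primeideal.axioms(1)[OF that]] A(1) B(1)
    by auto
  have mem_sum: "z \<in> I <+>\<^bsub>R\<^esub> J \<longleftrightarrow> (\<exists>x\<in>I. \<exists>y\<in>J. z = x \<oplus> y)" for z I J
    by (auto simp: set_add_def')
  \<comment> \<open>Stated for arbitrary ideals because it is applied twice: to \<open>Idl A\<close>
    and \<open>Idl B\<close>, then to the principal ideals of the powers.\<close>
  have comax: "\<exists>x\<in>I. \<exists>y\<in>J. x \<oplus> y = \<one>"
    if IJ: "ideal I R" "ideal J R" "\<And>P. primeideal P R \<Longrightarrow> \<not> (I \<subseteq> P \<and> J \<subseteq> P)" for I J
  proof -
    interpret I: ideal I R by (rule IJ(1))
    interpret J: ideal J R by (rule IJ(2))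
    have "I \<subseteq> I <+>\<^bsub>R\<^esub> J"
    proof
      fix x assume "x \<in> I"
      then show "x \<in> I <+>\<^bsub>R\<^esub> J"
        unfolding mem_sum by (intro bexI[of _ x] bexI[of _ \<zero>]) auto
    qed
    moreover have "J \<subseteq> I <+>\<^bsub>R\<^esub> J"
    proof
      fix x assume "x \<in> J"
      then show "x \<in> I <+>\<^bsub>R\<^esub> J"
        unfolding mem_sum by (intro bexI[of _ \<zero>] bexI[of _ x]) auto
    qed
    ultimately have "\<one> \<in> I <+>\<^bsub>R\<^esub> J"
      using IJ(3) by (intro one_mem_ideal_if_no_prime[OF add_ideals[OF IJ(1,2)]]) blast
    then show ?thesis unfolding mem_sum by metis
  qed
  obtain a b where ab: "a \<in> Idl A" "b \<in> Idl B" "a \<oplus> b = \<one>"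
    using comax[OF idA idB] inUI notinUI by blast
  have a: "a \<in> carrier R" and b: "b \<in> carrier R"
    using ab IA.Icarr IB.Icarr by auto
  have "a \<otimes> b \<in> P" if P: "primeideal P R" for P
  proof -
    interpret P: primeideal P R by fact
    have "a \<in> P \<or> b \<in> P"
      using ab inUI[OF P] notinUI[OF P] by blast
    then show ?thesis using a b P.I_l_closed P.I_r_closed by blast
  qed
  then obtain n :: nat where n: "(a \<otimes> b) [^] n = \<zero>"
    using nilpotent_if_in_all_primes a b by blast
  \<comment> \<open>The exponent \<open>Suc n\<close> is positive even for \<open>n = 0\<close>, so
    a prime containing \<open>a\<close> or \<open>b\<close> also contains its power; the last part
    of the proof relies on this.\<close>
  have anbn: "a [^] Suc n \<otimes> b [^] Suc n = \<zero>"
  proof -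
    have "a [^] Suc n \<otimes> b [^] Suc n = (a \<otimes> b) [^] Suc n"
      by (rule nat_pow_distrib[symmetric]) (use a b in auto)
    then show ?thesis using n a b by simp
  qed
  have "\<exists>x\<in>PIdl (a [^] Suc n). \<exists>y\<in>PIdl (b [^] Suc n). x \<oplus> y = \<one>"
  proof (rule comax)
    show "ideal (PIdl (a [^] Suc n)) R" "ideal (PIdl (b [^] Suc n)) R"
      using a b by (auto intro!: cgenideal_ideal simp del: nat_pow_Suc)
    fix P assume P: "primeideal P R"
    interpret P: primeideal P R by fact
    show "\<not> (PIdl (a [^] Suc n) \<subseteq> P \<and> PIdl (b [^] Suc n) \<subseteq> P)"
    proof
      assume "PIdl (a [^] Suc n) \<subseteq> P \<and> PIdl (b [^] Suc n) \<subseteq> P"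
      then have "a [^] Suc n \<in> P" "b [^] Suc n \<in> P"
        using a b cgenideal_self by (meson nat_pow_closed subsetD)+
      then have "a \<in> P" "b \<in> P"
        using P.pow_mem_imp_mem a b by blast+
      then show False
        using ab(3) P.a_closed P.one_notin by metis
    qed
  qed
  then obtain x y where x: "x \<in> carrier R" and y: "y \<in> carrier R"
    and xy: "x \<otimes> a [^] Suc n \<oplus> y \<otimes> b [^] Suc n = \<one>"
    unfolding cgenideal_def by blast
  define e f where "e = y \<otimes> b [^] Suc n" and "f = x \<otimes> a [^] Suc n"
  have pa: "a [^] Suc n \<in> carrier R" and pb: "b [^] Suc n \<in> carrier R"
    using a b nat_pow_closed by blast+
  have e: "e \<in> carrier R" and f: "f \<in> carrier R"
    using x y pa pb by (auto simp: e_def f_def simp del: nat_pow_Suc)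
  have sum: "e \<oplus> f = \<one>"
    using xy a_comm[OF e f] by (simp add: e_def f_def del: nat_pow_Suc)
  have "e \<otimes> f = (x \<otimes> y) \<otimes> (a [^] Suc n \<otimes> b [^] Suc n)"
    using x y pa pb by (simp add: e_def f_def m_ac del: nat_pow_Suc)
  then have prod: "e \<otimes> f = \<zero>"
    using anbn x y by (simp del: nat_pow_Suc)
  have "e = e \<otimes> (e \<oplus> f)" using sum e by simp
  also have "\<dots> = e \<otimes> e" using prod e f by (simp add: r_distr)
  finally have "e \<in> idempotents R" using e by (simp add: idempotents_iff)
  moreover have "P \<in> U \<longleftrightarrow> e \<notin> P" if P: "primeideal P R" for P
  proof -
    interpret P: primeideal P R by fact
    \<comment> \<open>\<open>f\<close> is a multiple of a power of \<open>a\<close>, which lies in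
      every prime of \<open>U\<close>; \<open>e\<close> is related in the same way to
      \<open>b\<close> and the primes outside \<open>U\<close>.\<close>
    have "f \<in> P" if "P \<in> U"
    proof -
      have "a \<in> P" using ab(1) inUI[OF P] that by blast
      then show ?thesis
        using a x by (auto simp: f_def intro!: P.I_l_closed)
    qed
    moreover have "e \<in> P" if "P \<notin> U"
    proof -
      have "b \<in> P" using ab(2) notinUI[OF P] that by blast
      then show ?thesis
        using b y by (auto simp: e_def intro!: P.I_l_closed)
    qed
    ultimately show ?thesis
      using mem_primeideal_iff_complement_notin[OF P e f sum prod] by blast
  qed
  then have "U = basic_open R e"
    using Usub by (auto simp: basic_open_def Spec_def)
  ultimately show ?thesis by blast
qed

lemma bij_betw_idempotents_clopens:
  "bij_betw (basic_open R) (idempotents R) (clopens (zariski_topology R))"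
proof (rule bij_betw_imageI[OF inj_on_basic_open_idempotents])
  show "basic_open R ` idempotents R = clopens (zariski_topology R)"
    using basic_open_idempotent_clopen clopen_is_basic_open by (intro equalityI subsetI) blast+
qed

end

theorem theorem4p8:
  fixes R :: "('a, 'b) ring_scheme" and \<kappa> :: "'a set set rel"
  assumes "cring R"
    and "\<kappa> = |connected_components_of (zariski_topology R)|"
  shows "finite (idempotents R) \<longleftrightarrow> |idempotents R| =o ctwo ^c \<kappa>"
proof -
  note bij = cring.bij_betw_idempotents_clopens[OF assms(1)]
  then have iso: "|idempotents R| =o |clopens (zariski_topology R)|"
    by (rule card_of_ordIsoI)
  have "finite (idempotents R) \<longleftrightarrow> finite (clopens (zariski_topology R))"
    by (rule bij_betw_finite[OF bij])
  also have "\<dots> \<longleftrightarrow> |clopens (zariski_topology R)| =o ctwo ^c \<kappa>"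
    unfolding assms(2) by (rule compact_space_finite_clopens_iff[OF cring.compact_space_zariski[OF assms(1)]])
  also have "\<dots> \<longleftrightarrow> |idempotents R| =o ctwo ^c \<kappa>"
    using iso ordIso_transitive[OF iso] ordIso_transitive[OF ordIso_symmetric[OF iso]] by (intro iffI)
  finally show ?thesis .
qed

end
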